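(* There exists a planar graph $G$ that is not $3$-defective $3$-correspondable; that is, there is a $3$-fold correspondence cover $\mathcal{H}$ of $G$ such that $G$ admits no $3$-defective $\mathcal{H}$-coloring.
   Context: All graphs are finite, simple and undirected. A correspondence cover of a graph $G$ is a pair $\mathcal{H}=(L,H)$ where $H$ is a graph and $L: V(G)\to 2^{V(H)}$ satisfies: (1) $\{L(v): v\in V(G)\}$ partitions $V(H)$; (2) each $L(v)$ is an independent set in $H$; (3) for all $u,v\in V(G)$, the edges of $H[L(u)\cup L(v)]$ form a matching, which is empty if $uv\notin E(G)$. The cover is $k$-fold if $|L(v)|\ge k$ for all $v$. Two colors $c,c'\in V(H)$ conflict if $cc'\in E(H)$. An $\mathcal{H}$-coloring is a map $\phi:V(G)\to V(H)$ with $\phi(v)\in L(v)$ for all $v$. It is $d$-defective if the subgraph of $H$ induced by the image of $\phi$ has maximum degree at most $d$, i.e., for every $v$, $\phi(v)$ conflicts with $\phi(u)$ for at most $d$ neighbors $u$ of $v$ in $G$. A graph $G$ is $d$-defective $k$-correspondable if it has a $d$-defective $\mathcal{H}$-coloring for every $k$-fold correspondence cover $\mathcal{H}$ of $G$. *)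

theory Defs
  imports "HOL-Analysis.Analysis" "Graph_Theory.Graph_Theory"
begin

text \<open>
  A finite simple undirected graph is a \<^locale>\<open>pair_graph\<close>: a finite, loopfree digraph whose arcs
  form a symmetric relation. An undirected edge \<open>uv\<close> is thus a pair of opposite arcs; \<open>uedges\<close>
  recovers the set of undirected edges \<open>{u, v}\<close>.
\<close>

definition uedges :: "('a, 'b) pre_digraph \<Rightarrow> 'a set set" where
  "uedges G = {{u, v} | u v. (u, v) \<in> arcs_ends G}"

definition matching :: "'a set set \<Rightarrow> bool" where
  "matching M \<longleftrightarrow> pairwise disjnt M"

text \<open>
  Topological planarity, with \<open>complex\<close> as the plane: vertices are distinct points, edges are arcs
  joining the points of their ends, an edge passes through no vertex other than its ends, and two
  distinct edges meet only in common ends.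
\<close>

definition plane_drawing ::
    "'a pair_pre_digraph \<Rightarrow> ('a \<Rightarrow> complex) \<Rightarrow> ('a set \<Rightarrow> real \<Rightarrow> complex) \<Rightarrow> bool" where
  "plane_drawing G p g \<longleftrightarrow>
     inj_on p (pverts G) \<and>
     (\<forall>e \<in> uedges (with_proj G).
        arc (g e) \<and> {pathstart (g e), pathfinish (g e)} = p ` e \<and>
        path_image (g e) \<inter> p ` pverts G = p ` e) \<and>
     (\<forall>e \<in> uedges (with_proj G). \<forall>e' \<in> uedges (with_proj G). e \<noteq> e' \<longrightarrow>
        path_image (g e) \<inter> path_image (g e') = p ` (e \<inter> e'))"

definition planar :: "'a pair_pre_digraph \<Rightarrow> bool" where
  "planar G \<longleftrightarrow> (\<exists>p g. plane_drawing G p g)"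

text \<open>
  The operator \<open>\<restriction>\<close> is the induced subgraph. The case \<open>u = v\<close> of the last condition is harmless:
  \<open>(v, v)\<close> is not an arc of \<open>G\<close>, and it then says again that \<open>L v\<close> is independent.
\<close>

definition correspondence_cover ::
    "'a pair_pre_digraph \<Rightarrow> ('a \<Rightarrow> 'c set) \<Rightarrow> 'c pair_pre_digraph \<Rightarrow> bool" where
  "correspondence_cover G L H \<longleftrightarrow>
     pair_graph H \<and>
     disjoint_family_on L (pverts G) \<and> (\<Union>v \<in> pverts G. L v) = pverts H \<and>
     (\<forall>v \<in> pverts G. uedges (with_proj H \<restriction> L v) = {}) \<and>
     (\<forall>u \<in> pverts G. \<forall>v \<in> pverts G.
        matching (uedges (with_proj H \<restriction> (L u \<union> L v))) \<and>
        ((u, v) \<notin> parcs G \<longrightarrow> uedges (with_proj H \<restriction> (L u \<union> L v)) = {}))"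

definition fold_cover :: "nat \<Rightarrow> 'a pair_pre_digraph \<Rightarrow> ('a \<Rightarrow> 'c set) \<Rightarrow> bool" where
  "fold_cover k G L \<longleftrightarrow> (\<forall>v \<in> pverts G. card (L v) \<ge> k)"

definition cover_coloring :: "'a pair_pre_digraph \<Rightarrow> ('a \<Rightarrow> 'c set) \<Rightarrow> ('a \<Rightarrow> 'c) \<Rightarrow> bool" where
  "cover_coloring G L \<phi> \<longleftrightarrow> (\<forall>v \<in> pverts G. \<phi> v \<in> L v)"

text \<open>
  As \<open>H\<close> is symmetric, the degree of a vertex is its out-degree.
\<close>

definition defective ::
    "nat \<Rightarrow> 'a pair_pre_digraph \<Rightarrow> 'c pair_pre_digraph \<Rightarrow> ('a \<Rightarrow> 'c) \<Rightarrow> bool" where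
  "defective d G H \<phi> \<longleftrightarrow>
     (\<forall>c \<in> \<phi> ` pverts G. out_degree (with_proj H \<restriction> (\<phi> ` pverts G)) c \<le> d)"

text \<open>
  Cover graphs are finite, so it is no restriction to take their vertices to be natural numbers.
\<close>

definition defective_correspondable :: "nat \<Rightarrow> nat \<Rightarrow> 'a pair_pre_digraph \<Rightarrow> bool" where
  "defective_correspondable d k G \<longleftrightarrow>
     (\<forall>(L :: 'a \<Rightarrow> nat set) (H :: nat pair_pre_digraph).
        correspondence_cover G L H \<and> fold_cover k G L \<longrightarrow>
        (\<exists>\<phi>. cover_coloring G L \<phi> \<and> defective d G H \<phi>))"

end

theory Submission
  imports Defs
begin

text \<open>
  Two poles are joined to every vertex of a long path \<open>x\<^sub>0, x\<^sub>1, \<dots>\<close>, and inside each of the two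
  triangles formed by a pole and an edge \<open>x\<^sub>i x\<^sub>i\<^sub>+\<^sub>1\<close> a vertex is placed that is joined to all three
  corners. Each edge carries a single conflict. As a pole has at most three conflicts, some block of
  five consecutive \<open>x\<^sub>i\<close>, designed for the colors that the poles actually have, is free of conflicts
  with the poles. There every \<open>x\<^sub>i\<close> is left with one color, which conflicts with the color of
  \<open>x\<^sub>i\<^sub>+\<^sub>1\<close>, and both inner vertices at \<open>x\<^sub>i x\<^sub>i\<^sub>+\<^sub>1\<close> conflict with \<open>x\<^sub>i\<close> or with \<open>x\<^sub>i\<^sub>+\<^sub>1\<close>. Each edge
  of the block thus adds four to the conflict degrees of its ends, one more than an \<open>x\<^sub>i\<close> can absorb,
  so that the surplus grows along the block until it cannot be placed.
\<close>

section \<open>Straight-line drawings\<close>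

text \<open>
  The function \<open>f\<close> tells from a point of the drawing which vertex or edge it lies on; its existence
  replaces the pairwise comparison of edges.
\<close>

lemma planar_straight_line:
  fixes p :: "'a \<Rightarrow> complex" and f :: "complex \<Rightarrow> 'a set"
  assumes G: "pair_graph G"
    and vertex: "\<And>v. v \<in> pverts G \<Longrightarrow> f (p v) = {v}"
    and edge: "\<And>u v z. (u, v) \<in> parcs G \<Longrightarrow> z \<in> open_segment (p u) (p v) \<Longrightarrow> f z = {u, v}"
  shows "planar G"
proof -
  interpret G: pair_graph G by fact
  \<comment> \<open>An unordered edge has no first end, so one of its two arcs is chosen to orient
    its segment.\<close>
  define ends where "ends e = (SOME uv. e = {fst uv, snd uv} \<and> uv \<in> parcs G)" for e
  define g where "g e = linepath (p (fst (ends e))) (p (snd (ends e)))" for e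
  have inj: "inj_on p (pverts G)"
    by (metis inj_onI singleton_inject vertex)
  have ends: "\<exists>u v. e = {u, v} \<and> (u, v) \<in> parcs G \<and> u \<in> pverts G \<and> v \<in> pverts G \<and> u \<noteq> v
      \<and> p u \<noteq> p v \<and> g e = linepath (p u) (p v)"
    if "e \<in> uedges (with_proj G)" for e
  proof -
    have "\<exists>uv. e = {fst uv, snd uv} \<and> uv \<in> parcs G"
      using that by (auto simp: uedges_def)
    then have e: "e = {fst (ends e), snd (ends e)}" "ends e \<in> parcs G"
      unfolding ends_def by (metis (mono_tags, lifting) someI_ex)+
    have V: "fst (ends e) \<in> pverts G" "snd (ends e) \<in> pverts G" "fst (ends e) \<noteq> snd (ends e)"
      using e(2) G.arc_fst_in_verts G.arc_snd_in_verts G.pair_no_loops by auto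
    then have "p (fst (ends e)) \<noteq> p (snd (ends e))"
      using inj by (auto dest: inj_onD)
    with e V show ?thesis
      unfolding g_def by (metis prod.collapse)
  qed
  \<comment> \<open>The size of \<open>f z\<close> separates ends from interior points, and an
    interior point names its edge. So no vertex lies inside an edge, and distinct edges share only
    ends.\<close>
  have f_image: "(z \<in> p ` e \<and> f z \<subseteq> e \<and> card (f z) = 1) \<or> (f z = e \<and> card (f z) = 2)"
    if e: "e \<in> uedges (with_proj G)" and z: "z \<in> path_image (g e)" for e z
  proof -
    obtain u v where uv: "e = {u, v}" "(u, v) \<in> parcs G" "u \<in> pverts G" "v \<in> pverts G" "u \<noteq> v"
        "g e = linepath (p u) (p v)"
      using ends[OF e] by blast
    with z have "z \<in> open_segment (p u) (p v) \<or> z = p u \<or> z = p v"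
      by (auto simp: closed_segment_eq_open)
    then show ?thesis
      using uv edge[OF uv(2)] vertex by auto
  qed
  have sub: "p ` e \<subseteq> path_image (g e)" "e \<subseteq> pverts G" if "e \<in> uedges (with_proj G)" for e
    using ends[OF that] by auto
  have "plane_drawing G p g"
    unfolding plane_drawing_def
  proof (intro conjI ballI impI)
    fix e assume e: "e \<in> uedges (with_proj G)"
    show "arc (g e)" "{pathstart (g e), pathfinish (g e)} = p ` e"
      using ends[OF e] by auto
    have "z \<in> p ` e" if "z \<in> path_image (g e)" "v \<in> pverts G" "z = p v" for z v
      using f_image[OF e that(1)] vertex[OF that(2)] that(3) by auto
    then show "path_image (g e) \<inter> p ` pverts G = p ` e"
      using sub[OF e] by auto
  next
    fix e e' assume e: "e \<in> uedges (with_proj G)" "e' \<in> uedges (with_proj G)" and ne: "e \<noteq> e'"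
    have "z \<in> p ` (e \<inter> e')" if z: "z \<in> path_image (g e)" "z \<in> path_image (g e')" for z
    proof -
      have "z \<in> p ` e" "z \<in> p ` e'"
        using f_image[OF e(1) z(1)] f_image[OF e(2) z(2)] ne by auto
      then show ?thesis
        using inj sub(2)[OF e(1)] sub(2)[OF e(2)] by (simp add: inj_on_image_Int)
    qed
    then show "path_image (g e) \<inter> path_image (g e') = p ` (e \<inter> e')"
      using sub(1)[OF e(1)] sub(1)[OF e(2)] by blast
  qed (fact inj)
  then show ?thesis
    by (auto simp: planar_def)
qed

section \<open>Covers with one conflict per edge\<close>

definition undirected :: "nat \<Rightarrow> (nat \<times> nat) set \<Rightarrow> nat pair_pre_digraph" where
  "undirected n A = \<lparr> pverts = {..<n}, parcs = A \<union> A\<inverse> \<rparr>"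

lemma undirected_simps [simp]:
  "pverts (undirected n A) = {..<n}"
  "(x, y) \<in> parcs (undirected n A) \<longleftrightarrow> (x, y) \<in> A \<or> (y, x) \<in> A"
  by (auto simp: undirected_def)

lemma pair_graph_undirected:
  assumes "\<And>x y. (x, y) \<in> A \<Longrightarrow> x < y \<and> y < n"
  shows "pair_graph (undirected n A)"
proof -
  have "A \<subseteq> {..<n} \<times> {..<n}"
    using assms by force
  then have fin: "finite A"
    by (rule finite_subset) simp
  show ?thesis
  proof
    fix e assume "e \<in> parcs (undirected n A)"
    then show "fst e \<in> pverts (undirected n A)" "snd e \<in> pverts (undirected n A)" "fst e \<noteq> snd e"
      using assms by (cases e; fastforce)+
  next
    show "finite (parcs (undirected n A))"
      using fin by (simp add: undirected_def)
  qed (auto simp: symmetric_def undirected_def sym_def)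
qed

text \<open>With this encoding the list of \<open>v\<close> is the fibre
  \<open>{c. c div 3 = v}\<close>, so lists are disjoint automatically.\<close>

definition col :: "nat \<Rightarrow> nat \<Rightarrow> nat" where
  "col v a = 3 * v + a"

lemma col_div [simp]: "a < 3 \<Longrightarrow> col v a div 3 = v"
  by (simp add: col_def)

text \<open>
  The color \<open>c\<close> belongs to the vertex \<open>c div 3\<close>, and \<open>A\<close> lists the conflicts, one for each edge.
\<close>

definition base_graph :: "nat \<Rightarrow> (nat \<times> nat) set \<Rightarrow> nat pair_pre_digraph" where
  "base_graph n A = undirected n (map_prod (\<lambda>c. c div 3) (\<lambda>c. c div 3) ` A)"

lemma uedges_induced:
  "uedges (with_proj H \<restriction> S) = {{x, y} | x y. (x, y) \<in> parcs H \<and> x \<in> S \<and> y \<in> S}"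
proof -
  have "arcs_ends (with_proj H \<restriction> S) = {(x, y). (x, y) \<in> parcs H \<and> x \<in> S \<and> y \<in> S}"
    by (force simp: arcs_ends_def arc_to_ends_def)
  then show ?thesis
    by (simp add: uedges_def)
qed

text \<open>Injectivity leaves one conflict over each edge, so at most one conflict joins two lists
  and the matching condition is trivial. The strict order of the ends makes lists
  independent.\<close>

lemma correspondence_cover_base_graph:
  assumes A: "\<And>c d. (c, d) \<in> A \<Longrightarrow> c div 3 < d div 3 \<and> d div 3 < n"
    and inj: "inj_on (map_prod (\<lambda>c. c div 3) (\<lambda>c. c div 3)) A"
  shows "correspondence_cover (base_graph n A) (\<lambda>v. {c. c div 3 = v}) (undirected (3 * n) A)"
  unfolding correspondence_cover_def
proof (intro conjI ballI impI)
  show "pair_graph (undirected (3 * n) A)"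
  proof (rule pair_graph_undirected)
    fix x y assume "(x, y) \<in> A"
    then have xy: "x div 3 < y div 3" "y div 3 < n"
      using A by auto
    have "x < y"
      using xy(1) div_le_mono[of y x 3] by linarith
    moreover have "y < 3 * n"
      using xy(2) by (simp add: div_less_iff_less_mult)
    ultimately show "x < y \<and> y < 3 * n" ..
  qed
  show "disjoint_family_on (\<lambda>v. {c. c div 3 = v}) (pverts (base_graph n A))"
    by (auto simp: disjoint_family_on_def)
  show "(\<Union>v\<in>pverts (base_graph n A). {c. c div 3 = v}) = pverts (undirected (3 * n) A)"
    by (auto simp: base_graph_def)
next
  fix v
  show "uedges (with_proj (undirected (3 * n) A) \<restriction> {c. c div 3 = v}) = {}"
    using A unfolding uedges_induced by fastforce
next
  fix u v
  let ?H = "with_proj (undirected (3 * n) A) \<restriction> ({c. c div 3 = u} \<union> {c. c div 3 = v})"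
  have E: "\<exists>c d. e = {c, d} \<and> (c, d) \<in> A \<and> c div 3 = min u v \<and> d div 3 = max u v"
    if e: "e \<in> uedges ?H" for e
  proof -
    obtain x y where "e = {x, y}" "(x, y) \<in> A \<or> (y, x) \<in> A" "x div 3 \<in> {u, v}" "y div 3 \<in> {u, v}"
      using e unfolding uedges_induced undirected_simps by blast
    then obtain c d where cd: "e = {c, d}" "(c, d) \<in> A" "c div 3 \<in> {u, v}" "d div 3 \<in> {u, v}"
      by (metis insert_commute)
    moreover have "c div 3 < d div 3"
      using A cd(2) by auto
    ultimately show ?thesis
      by (intro exI[of _ c] exI[of _ d]) auto
  qed
  have "e = e'" if e: "e \<in> uedges ?H" "e' \<in> uedges ?H" for e e'
  proof -
    obtain c d c' d' where "e = {c, d}" "(c, d) \<in> A" "e' = {c', d'}" "(c', d') \<in> A"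
        "c div 3 = c' div 3" "d div 3 = d' div 3"
      using E[OF e(1)] E[OF e(2)] by metis
    then show ?thesis
      using inj_onD[OF inj, of "(c, d)" "(c', d')"] by simp
  qed
  then show "matching (uedges ?H)"
    by (auto simp: matching_def pairwise_def)
  assume "(u, v) \<notin> parcs (base_graph n A)"
  moreover have "(u, v) \<in> parcs (base_graph n A)"
    if "(c, d) \<in> A" "c div 3 = min u v" "d div 3 = max u v" for c d
  proof -
    have "(min u v, max u v) \<in> map_prod (\<lambda>c. c div 3) (\<lambda>c. c div 3) ` A"
      using that by force
    then show ?thesis
      by (auto simp: base_graph_def min_def max_def split: if_splits)
  qed
  ultimately show "uedges ?H = {}"
    using E by blast
qed

lemma fold_cover_3: "fold_cover 3 G (\<lambda>v :: nat. {c. c div 3 = v})"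
proof -
  have "{c. c div 3 = v} = {3 * v..<3 * v + 3}" for v :: nat
  proof -
    have "c div 3 = v \<longleftrightarrow> 3 * v \<le> c \<and> c < 3 * v + 3" for c
      by (auto intro!: div_nat_eqI)
    then show ?thesis
      by (simp add: set_eq_iff)
  qed
  then show ?thesis
    by (simp add: fold_cover_def)
qed

text \<open>Distinct vertices have colors in distinct fibres of \<open>div 3\<close>, so the
  conflicts of \<open>\<phi> v\<close> can be counted by vertices.\<close>

lemma card_conflicts_le:
  assumes \<phi>: "cover_coloring (undirected n A) (\<lambda>v. {c. c div 3 = v}) \<phi>"
    and d: "defective d (undirected n A) H \<phi>" and H: "finite (parcs H)"
    and v: "v < n" and S: "S \<subseteq> {..<n}" "\<And>w. w \<in> S \<Longrightarrow> (\<phi> v, \<phi> w) \<in> parcs H"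
  shows "card S \<le> d"
proof -
  have inj: "inj_on (\<lambda>w. (\<phi> v, \<phi> w)) S"
  proof (rule inj_onI)
    fix x y assume xy: "x \<in> S" "y \<in> S" and eq: "(\<phi> v, \<phi> x) = (\<phi> v, \<phi> y)"
    have "\<phi> x div 3 = x" "\<phi> y div 3 = y"
      using S(1) \<phi> xy by (auto simp: cover_coloring_def)
    then show "x = y"
      using eq by (metis prod.inject)
  qed
  let ?out = "out_arcs (with_proj H \<restriction> (\<phi> ` {..<n})) (\<phi> v)"
  have "card S = card ((\<lambda>w. (\<phi> v, \<phi> w)) ` S)"
    using inj by (simp add: card_image)
  also have "\<dots> \<le> card ?out"
  proof (rule card_mono)
    show "finite ?out"
      using H by (rule rev_finite_subset) (auto simp: out_arcs_def)
    show "(\<lambda>w. (\<phi> v, \<phi> w)) ` S \<subseteq> ?out"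
      using S v by (auto simp: out_arcs_def)
  qed
  also have "\<dots> \<le> d"
    using d v by (auto simp: defective_def out_degree_def)
  finally show ?thesis .
qed

section \<open>The graph\<close>

text \<open>Triples follow the poles in an order that makes every listed edge increasing. The path
  ends at \<open>equator N\<close>, which is \<open>3 * N + 2\<close>; hence
  \<open>3 * N + 3\<close> vertices.\<close>

definition equator :: "nat \<Rightarrow> nat" where "equator i = 3 * i + 2"
definition north :: "nat \<Rightarrow> nat" where "north i = 3 * i + 3"
definition south :: "nat \<Rightarrow> nat" where "south i = 3 * i + 4"

lemma vertex_simps [simp]:
  "equator i = equator j \<longleftrightarrow> i = j" "north i = north j \<longleftrightarrow> i = j" "south i = south j \<longleftrightarrow> i = j"
  "equator i \<noteq> north j" "equator i \<noteq> south j" "north i \<noteq> south j"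
  "north j \<noteq> equator i" "south j \<noteq> equator i" "south j \<noteq> north i"
  "equator i \<noteq> 0" "north i \<noteq> 0" "south i \<noteq> 0"
  "0 \<noteq> equator i" "0 \<noteq> north i" "0 \<noteq> south i"
  "equator i \<noteq> Suc 0" "north i \<noteq> Suc 0" "south i \<noteq> Suc 0"
  "Suc 0 \<noteq> equator i" "Suc 0 \<noteq> north i" "Suc 0 \<noteq> south i"
  unfolding equator_def north_def south_def by presburger+

text \<open>
  The poles are \<open>0\<close> and \<open>1\<close>. The vertices of block \<open>j = i div 5\<close> lose a color if the poles have the
  colors \<open>j mod 3\<close> and \<open>j div 3 mod 3\<close>. So each of the nine pairs of colors has one block among any
  nine consecutive ones, and \<open>7 \<cdot> 9 \<cdot> 5 = 315\<close> gives it the seven blocks of which the at most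
  \<open>3 + 3\<close> conflicts of the poles miss one.
\<close>

definition conflicts :: "nat \<Rightarrow> (nat \<times> nat) set" where
  "conflicts N = (\<Union>i<N.
     {(col 0 (i div 5 mod 3), col (equator i) 0),
      (col 0 (i div 5 mod 3), col (north i) 0),
      (col 1 (i div 15 mod 3), col (equator i) 1),
      (col 1 (i div 15 mod 3), col (south i) 0),
      (col (equator i) 2, col (north i) 1),
      (col (north i) 2, col (equator (Suc i)) 2),
      (col (equator i) 2, col (south i) 1),
      (col (south i) 2, col (equator (Suc i)) 2),
      (col (equator i) 2, col (equator (Suc i)) 2)})"

definition edges :: "nat \<Rightarrow> (nat \<times> nat) set" where
  "edges N = (\<Union>i<N.
     {(0, equator i), (0, north i), (1, equator i), (1, south i),
      (equator i, north i), (north i, equator (Suc i)),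
      (equator i, south i), (south i, equator (Suc i)), (equator i, equator (Suc i))})"

lemma edges_conflicts: "map_prod (\<lambda>c. c div 3) (\<lambda>c. c div 3) ` conflicts N = edges N"
  by (simp add: conflicts_def edges_def image_UN)

text \<open>An edge determines its index \<open>i\<close> and its kind among the nine, hence its
  conflict.\<close>

lemma inj_on_conflicts: "inj_on (map_prod (\<lambda>c. c div 3) (\<lambda>c. c div 3)) (conflicts N)"
  unfolding conflicts_def by (rule inj_onI) (elim UN_E insertE; simp)

lemma edges_less: "(u, v) \<in> edges N \<Longrightarrow> u < v \<and> v < 3 * N + 3"
  by (auto simp: edges_def equator_def north_def south_def)

lemma conflicts_less: "(c, d) \<in> conflicts N \<Longrightarrow> c div 3 < d div 3 \<and> d div 3 < 3 * N + 3"
  using edges_less map_prod_imageI[of c d "conflicts N"] unfolding edges_conflicts[symmetric] by blast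


section \<open>Planarity\<close>

text \<open>\<open>north i\<close> and \<open>south i\<close> are the midpoints between their pole
  and the real point \<open>i + 1 / 2\<close>.\<close>

definition position :: "nat \<Rightarrow> complex" where
  "position v = (if v = 0 then Complex 0 1 else if v = 1 then Complex 0 (- 1) else
     let i = real ((v - 2) div 3); k = (v - 2) mod 3 in
     if k = 0 then Complex i 0 else Complex ((2 * i + 1) / 4) (if k = 1 then 1 / 2 else - 1 / 2))"

lemma position_simps [simp]:
  "position 0 = Complex 0 1" "position (Suc 0) = Complex 0 (- 1)"
  "position (equator i) = Complex (real i) 0"
  "position (north i) = Complex ((2 * real i + 1) / 4) (1 / 2)"
  "position (south i) = Complex ((2 * real i + 1) / 4) (- 1 / 2)"
proof -
  have digits: "(equator i - 2) div 3 = i" "(equator i - 2) mod 3 = 0"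
      "(north i - 2) div 3 = i" "(north i - 2) mod 3 = 1"
      "(south i - 2) div 3 = i" "(south i - 2) mod 3 = 2"
    by (simp_all add: equator_def north_def south_def) presburger+
  show "position (equator i) = Complex (real i) 0"
      "position (north i) = Complex ((2 * real i + 1) / 4) (1 / 2)"
      "position (south i) = Complex ((2 * real i + 1) / 4) (- 1 / 2)"
    by (simp_all add: position_def Let_def digits)
qed (simp_all add: position_def)

text \<open>
  \<open>Re z / (1 - \<bar>Im z\<bar>)\<close> is the central projection of \<open>z\<close> to the real axis from the pole
  \<open>\<plusminus>\<i>\<close> on its side.
\<close>

definition address :: "complex \<Rightarrow> nat set" where
  "address z =
     (let y = \<bar>Im z\<bar>; t = Re z / (1 - y); i = nat \<lfloor>t\<rfloor>; r = frac t;
          pole = (if Im z > 0 then 0 else 1);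
          mid = (if Im z > 0 then north i else south i)
      in if y = 1 then {pole}
         else if r = 0 then (if y = 0 then {equator i} else {pole, equator i})
         else if y = 0 then {equator i, equator (Suc i)}
         else if r = 1 / 2 then (if y = 1 / 2 then {mid} else {pole, mid})
         else if r < 1 / 2 then {equator i, mid}
         else {mid, equator (Suc i)})"

text \<open>With the projection supplied as \<open>i + r\<close>, floor and fractional part are
  settled once and only comparisons of \<open>r\<close> and \<open>y\<close> remain.\<close>

lemma address_Complex:
  assumes "x = (real i + r) * (1 - \<bar>y\<bar>)" "0 \<le> r" "r < 1" "\<bar>y\<bar> < 1"
  shows "address (Complex x y) =
     (let pole = (if y > 0 then 0 else 1);
          mid = (if y > 0 then north i else south i)
      in if r = 0 then (if y = 0 then {equator i} else {pole, equator i})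
         else if y = 0 then {equator i, equator (Suc i)}
         else if r = 1 / 2 then (if \<bar>y\<bar> = 1 / 2 then {mid} else {pole, mid})
         else if r < 1 / 2 then {equator i, mid}
         else {mid, equator (Suc i)})"
proof -
  have t: "x / (1 - \<bar>y\<bar>) = real i + r"
    using assms by simp
  have floor: "\<lfloor>real i + r\<rfloor> = int i"
    using assms by (intro floor_unique) auto
  then have frac: "frac (real i + r) = r"
    by (simp add: frac_def)
  have "\<bar>y\<bar> \<noteq> 1" "\<bar>y\<bar> = 0 \<longleftrightarrow> y = 0"
    using assms(4) by auto
  then show ?thesis
    unfolding address_def Let_def complex.sel t floor frac nat_int by (simp only: if_False)
qed

lemma address_position: "address (position v) = {v}"
proof -
  define i where "i = (v - 2) div 3"
  have "v = 0 \<or> v = Suc 0 \<or> v = equator i \<or> v = north i \<or> v = south i"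
    unfolding equator_def north_def south_def i_def by presburger
  moreover have "address (Complex 0 1) = {0}" "address (Complex 0 (- 1)) = {Suc 0}"
    by (simp_all add: address_def)
  moreover have "address (Complex (real i) 0) = {equator i}"
    by (subst address_Complex[where i = i and r = 0]) auto
  moreover have "address (Complex ((2 * real i + 1) / 4) (1 / 2)) = {north i}"
    by (subst address_Complex[where i = i and r = "1 / 2"]) (auto simp: field_simps)
  moreover have "address (Complex ((2 * real i + 1) / 4) (- 1 / 2)) = {south i}"
    by (subst address_Complex[where i = i and r = "1 / 2"]) (auto simp: field_simps)
  ultimately show ?thesis
    by auto
qed

text \<open>Along an edge at a pole the projection is constant, with fractional part
  \<open>0\<close> or \<open>1 / 2\<close>. Along the other edges it increases within one unit
  interval.\<close>

lemma address_edge: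
  assumes "(u, v) \<in> edges N" "z \<in> open_segment (position u) (position v)"
  shows "address z = {u, v}"
proof -
  obtain s where s: "0 < s" "s < 1" and z: "z = (1 - s) *\<^sub>R position u + s *\<^sub>R position v"
    using assms(2) by (auto simp: in_segment)
  obtain i where
    "(u, v) \<in> {(0, equator i), (0, north i), (1, equator i), (1, south i),
      (equator i, north i), (north i, equator (Suc i)),
      (equator i, south i), (south i, equator (Suc i)), (equator i, equator (Suc i))}"
    using assms(1) unfolding edges_def by blast
  then consider "u = 0" "v = equator i" | "u = 0" "v = north i"
    | "u = Suc 0" "v = equator i" | "u = Suc 0" "v = south i"
    | "u = equator i" "v = north i" | "u = north i" "v = equator (Suc i)"
    | "u = equator i" "v = south i" | "u = south i" "v = equator (Suc i)"
    | "u = equator i" "v = equator (Suc i)"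
    by auto
  then show ?thesis
  proof cases
    case 1
    have z': "z = Complex (s * i) (1 - s)"
      unfolding z 1 position_simps by (simp add: complex_eq_iff field_simps)
    show ?thesis
      unfolding z' 1
      by (subst address_Complex[where i = i and r = 0]) (use s in auto)
  next
    case 2
    have z': "z = Complex (s * (2 * i + 1) / 4) (1 - s / 2)"
      unfolding z 2 position_simps by (simp add: complex_eq_iff field_simps)
    show ?thesis
      unfolding z' 2
      by (subst address_Complex[where i = i and r = "1 / 2"])
        (use s in \<open>auto simp: field_simps\<close>)
  next
    case 3
    have z': "z = Complex (s * i) (s - 1)"
      unfolding z 3 position_simps by (simp add: complex_eq_iff field_simps)
    show ?thesis
      unfolding z' 3
      by (subst address_Complex[where i = i and r = 0]) (use s in auto)
  next
    case 4
    have z': "z = Complex (s * (2 * i + 1) / 4) (s / 2 - 1)"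
      unfolding z 4 position_simps by (simp add: complex_eq_iff field_simps)
    show ?thesis
      unfolding z' 4
      by (subst address_Complex[where i = i and r = "1 / 2"])
        (use s in \<open>auto simp: field_simps\<close>)
  next
    case 5
    have z': "z = Complex ((1 - s) * i + s * (2 * i + 1) / 4) (s / 2)"
      unfolding z 5 position_simps by (simp add: complex_eq_iff field_simps)
    show ?thesis
      unfolding z' 5
      \<comment> \<open>This \<open>r\<close> is \<open>Re z / (1 - s / 2) - i\<close>; it runs from
        \<open>0\<close> to \<open>1 / 2\<close>.\<close>
      by (subst address_Complex[where i = i and r = "s / (4 - 2 * s)"])
        (use s in \<open>auto simp: field_simps\<close>)
  next
    case 6
    have z': "z = Complex ((1 - s) * (2 * i + 1) / 4 + s * (i + 1)) ((1 - s) / 2)"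
      unfolding z 6 position_simps by (simp add: complex_eq_iff field_simps)
    show ?thesis
      unfolding z' 6
      \<comment> \<open>Here \<open>1 - \<bar>Im z\<bar>\<close> is \<open>(1 + s) / 2\<close>, and
        \<open>r\<close> runs from \<open>1 / 2\<close> to \<open>1\<close>.\<close>
      by (subst address_Complex[where i = i and r = "(1 + 3 * s) / (2 + 2 * s)"])
        (use s in \<open>auto simp: field_simps\<close>)
  next
    case 7
    have z': "z = Complex ((1 - s) * i + s * (2 * i + 1) / 4) (- s / 2)"
      unfolding z 7 position_simps by (simp add: complex_eq_iff field_simps)
    show ?thesis
      unfolding z' 7
      by (subst address_Complex[where i = i and r = "s / (4 - 2 * s)"])
        (use s in \<open>auto simp: field_simps\<close>)
  next
    case 8
    have z': "z = Complex ((1 - s) * (2 * i + 1) / 4 + s * (i + 1)) (- (1 - s) / 2)"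
      unfolding z 8 position_simps by (simp add: complex_eq_iff field_simps)
    show ?thesis
      unfolding z' 8
      by (subst address_Complex[where i = i and r = "(1 + 3 * s) / (2 + 2 * s)"])
        (use s in \<open>auto simp: field_simps\<close>)
  next
    case 9
    have z': "z = Complex (i + s) 0"
      unfolding z 9 position_simps by (simp add: complex_eq_iff field_simps)
    show ?thesis
      unfolding z' 9
      by (subst address_Complex[where i = i and r = s]) (use s in auto)
  qed
qed

definition bad_graph :: "nat \<Rightarrow> nat pair_pre_digraph" where
  "bad_graph N = undirected (3 * N + 3) (edges N)"

lemma pair_graph_bad_graph: "pair_graph (bad_graph N)"
  unfolding bad_graph_def by (rule pair_graph_undirected) (rule edges_less)

lemma planar_bad_graph: "planar (bad_graph N)"
proof (rule planar_straight_line[where p = position and f = address])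
  fix u v z assume "(u, v) \<in> parcs (bad_graph N)" "z \<in> open_segment (position u) (position v)"
  then show "address z = {u, v}"
    unfolding bad_graph_def undirected_simps
    by (metis address_edge insert_commute open_segment_commute)
qed (simp_all add: pair_graph_bad_graph address_position)

section \<open>Defective colorings\<close>

lemma not_defective_conflicts:
  assumes \<phi>: "cover_coloring (bad_graph 315) (\<lambda>v. {c. c div 3 = v}) \<phi>"
    and d: "defective 3 (bad_graph 315) (undirected (3 * (3 * 315 + 3)) (conflicts 315)) \<phi>"
  shows False
proof -
  let ?n = "3 * 315 + 3 :: nat"
  let ?H = "undirected (3 * ?n) (conflicts 315)"
  define c where "c v = \<phi> v mod 3" for v
  have c3: "c v < 3" for v
    by (simp add: c_def)
  have \<phi>_eq: "\<phi> v = col v (c v)" if "v < ?n" for v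
    using \<phi> that mult_div_mod_eq[of 3 "\<phi> v"] by (auto simp: cover_coloring_def bad_graph_def c_def col_def)
  have fin: "finite (parcs ?H)"
    by (simp add: undirected_def conflicts_def)
  have deg: "card S \<le> 3"
    if "v < ?n" "S \<subseteq> {..<?n}" "\<And>w. w \<in> S \<Longrightarrow> (\<phi> v, \<phi> w) \<in> parcs ?H" for v S
    using card_conflicts_le[OF \<phi>[unfolded bad_graph_def] d[unfolded bad_graph_def] fin] that by blast
  define \<alpha> where "\<alpha> = c 0"
  define \<beta> where "\<beta> = c 1"
  define T where "T v = {w \<in> {..<?n}. (\<phi> v, \<phi> w) \<in> parcs ?H}" for v
  have "card (T 0 \<union> T 1) \<le> 3 + 3"
    using deg[of 0 "T 0"] deg[of 1 "T 1"] card_Un_le[of "T 0" "T 1"] by (force simp: T_def)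
  moreover have "finite (T 0 \<union> T 1)"
    by (simp add: T_def)
  \<comment> \<open>\<open>(w - 2) div 3\<close> is the index of a vertex \<open>w\<close> other
    than a pole, and \<open>45\<close> indices make a group of nine blocks. At most six conflicts
    cannot meet all seven groups.\<close>
  ultimately have "card ((\<lambda>w. (w - 2) div 3 div 45) ` (T 0 \<union> T 1)) < card {..<7 :: nat}"
    using card_image_le[of "T 0 \<union> T 1" "\<lambda>w. (w - 2) div 3 div 45"] by simp
  then obtain k where k: "k < 7" "k \<notin> (\<lambda>w. (w - 2) div 3 div 45) ` (T 0 \<union> T 1)"
    by (metis card_mono \<open>finite (T 0 \<union> T 1)\<close> finite_imageI lessThan_iff linorder_not_less subsetI)
  \<comment> \<open>In the free group \<open>k\<close>, block number
    \<open>9 * k + 3 * \<beta> + \<alpha>\<close> is the one designed for the pole colors;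
    \<open>b\<close> is its first index.\<close>
  define b where "b = 45 * k + 15 * \<beta> + 5 * \<alpha>"
  have \<alpha>\<beta>: "\<alpha> < 3" "\<beta> < 3"
    by (simp_all add: \<alpha>_def \<beta>_def c3)
  have types: "(b + r) div 5 mod 3 = \<alpha>" "(b + r) div 15 mod 3 = \<beta>" "(b + r) div 45 = k" "b + r < 315"
    if r: "r < 5" for r
  proof -
    have "(b + r) div 5 = 3 * (3 * k + \<beta>) + \<alpha>" "(b + r) div 15 = 3 * k + \<beta>"
      using r \<alpha>\<beta> by (intro div_nat_eqI; simp add: b_def)+
    then show "(b + r) div 5 mod 3 = \<alpha>" "(b + r) div 15 mod 3 = \<beta>"
      using \<alpha>\<beta> by (simp_all only: mod_mult_self4 mod_less)
    show "(b + r) div 45 = k"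
      using r \<alpha>\<beta> by (intro div_nat_eqI; simp add: b_def)
    show "b + r < 315"
      using r \<alpha>\<beta> k(1) by (simp add: b_def)
  qed
  have range: "equator (b + r) < ?n" "north (b + r) < ?n" "south (b + r) < ?n" if "r < 5" for r
    using types(4)[OF that] by (auto simp: equator_def north_def south_def)
  have block: "w \<notin> T 0 \<union> T 1" if "w \<in> {equator (b + r), north (b + r), south (b + r)}" "r < 5" for w r
  proof -
    have "(w - 2) div 3 = b + r"
      using that(1) by (auto simp: equator_def north_def south_def)
    then have "(w - 2) div 3 div 45 = k"
      using types(3)[OF that(2)] by simp
    then show ?thesis
      using k(2) by force
  qed
  have conflict: "(x, y) \<in> conflicts 315"
    if "(x, y) \<in> {(col 0 \<alpha>, col (equator (b + r)) 0),
      (col 0 \<alpha>, col (north (b + r)) 0),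
      (col 1 \<beta>, col (equator (b + r)) 1),
      (col 1 \<beta>, col (south (b + r)) 0),
      (col (equator (b + r)) 2, col (north (b + r)) 1),
      (col (north (b + r)) 2, col (equator (Suc (b + r))) 2),
      (col (equator (b + r)) 2, col (south (b + r)) 1),
      (col (south (b + r)) 2, col (equator (Suc (b + r))) 2),
      (col (equator (b + r)) 2, col (equator (Suc (b + r))) 2)}" "r < 5" for x y r
    using that(1) types[OF that(2)] unfolding conflicts_def by (intro UN_I[of "b + r"]) auto
  have avoid: "c w \<noteq> a"
    if "(col 0 \<alpha>, col w a) \<in> conflicts 315 \<or> (col 1 \<beta>, col w a) \<in> conflicts 315"
      "w < ?n" "w \<notin> T 0 \<union> T 1" for w a
    using that by (auto simp: T_def \<phi>_eq \<alpha>_def \<beta>_def)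
  \<comment> \<open>Being free of conflicts with the poles, the vertex avoids \<open>0\<close>
    because of pole \<open>0\<close> and \<open>1\<close> because of pole \<open>1\<close>.\<close>
  have x: "c (equator (b + r)) = 2" if r: "r < 5" for r
  proof -
    have "c (equator (b + r)) \<noteq> 0" "c (equator (b + r)) \<noteq> 1"
      using r range[OF r] by (intro avoid block[where r = r]; simp add: conflict[where r = r])+
    then show ?thesis
      using c3[of "equator (b + r)"] by linarith
  qed
  have yz: "c (north (b + r)) \<noteq> 0" "c (south (b + r)) \<noteq> 0" if r: "r < 5" for r
    using r range[OF r] by (intro avoid block[where r = r]; simp add: conflict[where r = r])+
  \<comment> \<open>\<open>R 1 r\<close> conflicts with \<open>equator (b + r)\<close>, and \<open>R 2 r\<close> with \<open>equator (b + Suc r)\<close>.\<close>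
  define R where "R a r = {w \<in> {north (b + r), south (b + r)}. c w = a}" for a r
  \<comment> \<open>Color \<open>0\<close> is lost, so each of the two inner vertices counts in
    exactly one of \<open>R 1 r\<close> and \<open>R 2 r\<close>.\<close>
  have split: "card (R 1 r) + card (R 2 r) = 2" if r: "r < 5" for r
  proof -
    have "R 1 r \<union> R 2 r = {north (b + r), south (b + r)}"
      using yz[OF r] c3[of "north (b + r)"] c3[of "south (b + r)"] by (auto simp: R_def)
    moreover have "R 1 r \<inter> R 2 r = {}" "finite (R 1 r)" "finite (R 2 r)"
      by (auto simp: R_def)
    ultimately show ?thesis
      by (metis card_2_iff card_Un_disjoint vertex_simps(6))
  qed
  \<comment> \<open>\<open>equator (b + Suc r)\<close> conflicts with both its path neighbors, which
    leaves room for one of \<open>R 2 r\<close> and \<open>R 1 (Suc r)\<close>; \<open>split\<close>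
    turns this into growth. The bound on \<open>r\<close> keeps the right neighbor in the
    block.\<close>
  have step: "card (R 2 (Suc r)) > card (R 2 r)" if r: "r < 3" for r
  proof -
    let ?S = "{equator (b + r), equator (b + Suc (Suc r))} \<union> (R 2 r \<union> R 1 (Suc r))"
    have "card ?S \<le> 3"
    proof (rule deg[of "equator (b + Suc r)"])
      show "equator (b + Suc r) < ?n"
        using range(1)[of "Suc r"] r by simp
      show "?S \<subseteq> {..<?n}"
        using range[of r] range[of "Suc r"] range[of "Suc (Suc r)"] r by (auto simp: R_def)
      fix w assume w: "w \<in> ?S"
      then consider "w = equator (b + r)" | "w = equator (b + Suc (Suc r))"
        | "w = north (b + r)" "c w = 2" | "w = south (b + r)" "c w = 2"
        | "w = north (b + Suc r)" "c w = 1" | "w = south (b + Suc r)" "c w = 1"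
        unfolding R_def by blast
      then have "(col w (c w), col (equator (b + Suc r)) 2) \<in> conflicts 315
          \<or> (col (equator (b + Suc r)) 2, col w (c w)) \<in> conflicts 315"
      proof cases
        case 1
        then show ?thesis using x[of r] r by (simp add: conflict[where r = r])
      next
        case 2
        then show ?thesis using x[of "Suc (Suc r)"] r by (simp add: conflict[where r = "Suc r"])
      next
        case 3
        then show ?thesis using r by (simp add: conflict[where r = r])
      next
        case 4
        then show ?thesis using r by (simp add: conflict[where r = r])
      next
        case 5
        then show ?thesis using r by (simp add: conflict[where r = "Suc r"])
      next
        case 6
        then show ?thesis using r by (simp add: conflict[where r = "Suc r"])
      qed
      moreover have "w < ?n" "equator (b + Suc r) < ?n"
        using w \<open>?S \<subseteq> {..<?n}\<close> \<open>equator (b + Suc r) < ?n\<close> by blast+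
      ultimately show "(\<phi> (equator (b + Suc r)), \<phi> w) \<in> parcs ?H"
        using x[of "Suc r"] r by (simp only: \<phi>_eq undirected_simps) auto
    qed
    moreover have "card ?S = 2 + (card (R 2 r) + card (R 1 (Suc r)))"
      by (subst card_Un_disjoint; (subst card_Un_disjoint)?) (auto simp: R_def)
    ultimately show ?thesis
      using split[of "Suc r"] r by simp
  qed
  \<comment> \<open>Three inner path vertices force three increases, but only two inner vertices are
    available; this is why blocks have length five.\<close>
  have "card (R 2 3) \<ge> 3"
    using step[of 0] step[of 1] step[of 2] by (simp add: numeral_eq_Suc)
  then show False
    using split[of 3] by simp
qed

theorem theorem1p2:
  shows "\<exists>G :: nat pair_pre_digraph.
    pair_graph G \<and> planar G \<and> \<not> defective_correspondable 3 3 G"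
proof (intro exI conjI)
  let ?L = "\<lambda>v :: nat. {c. c div 3 = v}"
  have "correspondence_cover (base_graph (3 * 315 + 3) (conflicts 315)) ?L
      (undirected (3 * (3 * 315 + 3)) (conflicts 315))"
    by (rule correspondence_cover_base_graph[OF conflicts_less inj_on_conflicts])
  then have "correspondence_cover (bad_graph 315) ?L
      (undirected (3 * (3 * 315 + 3)) (conflicts 315))"
    by (simp only: base_graph_def bad_graph_def edges_conflicts)
  then show "\<not> defective_correspondable 3 3 (bad_graph 315)"
    using fold_cover_3 not_defective_conflicts unfolding defective_correspondable_def by blast
qed (fact pair_graph_bad_graph planar_bad_graph)+

end
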